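(* Let $-\infty<a<b<\infty$. Consider the multi-term equation $${}^{C}D_a^{\alpha_k}x(t)=f\bigl(t,x(t),{}^{C}D_a^{\alpha_1}x(t),{}^{C}D_a^{\alpha_2}x(t),\ldots,{}^{C}D_a^{\alpha_{k-1}}x(t)\bigr),\qquad t\in[a,b],\tag{A}$$ subject to the initial conditions $$(D^jx)(a)=x_a^{(j)},\qquad j=0,1,\ldots,\lceil\alpha_k\rceil-1,\tag{B}$$ with given real numbers $x_a^{(j)}$, where $\alpha_k>\alpha_{k-1}>\cdots>\alpha_1>0$ are real numbers with $\alpha_j-\alpha_{j-1}\le 1$ for all $j=2,\ldots,k$ and $0<\alpha_1\le 1$, and $f:[a,b]\times\mathbb{R}^k\to\mathbb{R}$ is continuous. Assume further that no integer lies strictly between two consecutive numbers $\alpha_{j-1},\alpha_j$, $j=2,\ldots,k$. Put $\beta_1:=\alpha_1$ and $\beta_j:=\alpha_j-\alpha_{j-1}$ for $j=2,\ldots,k$. Then the multi-term equation (A) with the initial conditions (B) is equivalent to the system $$\begin{array}{rcl}{}^{C}D_a^{\beta_1}x_1(t)&=&x_2(t),\\ {}^{C}D_a^{\beta_2}x_2(t)&=&x_3(t),\\ &\vdots&\\ {}^{C}D_a^{\beta_{k-1}}x_{k-1}(t)&=&x_k(t),\\ {}^{C}D_a^{\beta_k}x_k(t)&=&f\bigl(t,x_1(t),x_2(t),\ldots,x_k(t)\bigr)\end{array}\tag{C}$$ with the initial conditions, for $j=1,\ldots,k$, $$x_j(a)=\begin{cases}x_a^{(0)},&\text{if } j=1,\\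 x_a^{(l)},&\text{if } j\ge 2 \text{ and } \alpha_{j-1}=l\in\mathbb{N},\\ 0,&\text{else},\end{cases}\tag{D}$$ in the following sense. 1. Whenever the function $x\in C^{\lceil\alpha_k\rceil-1}[a,b]$ is a solution of the multi-term Caputo fractional differential equation (A) with the initial conditions (B), the vector function $X:=(x_1,\ldots,x_k)^T$ with $x_1(t):=x(t)$ and $x_j(t):={}^{C}D_a^{\alpha_{j-1}}x(t)$ for $j\ge 2$ is a solution of the multi-order Caputo fractional differential system (C) with initial conditions (D). 2. Whenever the vector function $X:=(x_1,\ldots,x_k)^T$ is a solution of the multi-order Caputo fractional differential system (C) with initial conditions (D), the function $x:=x_1$ solves the multi-term Caputo fractional differential equation (A) with the initial conditions (B) on $[a,b]$.
   Context: For $\alpha>0$, $J_a^\alpha f(x):=\frac{1}{\Gamma(\alpha)}\int_a^x (x-t)^{\alpha-1}f(t)\,dt$ for $a\le x\le b$; $J_a^0$ is the identity. $D^m$ denotes the ordinary derivative of integer order $m$. For $\alpha>0$ and $m:=\lceil\alpha\rceil$ put ${}^{RL}D_a^{\alpha}f:=D^mJ_a^{m-\alpha}f$. For $\alpha>0$, $m:=\lceil\alpha\rceil$ and $f\in C^{m-1}[a,b]$, the Caputo fractional derivative of order $\alpha$ is ${}^{C}D_a^{\alpha}f:={}^{RL}D_a^{\alpha}(f-T_{m-1}[f;a])$, where $T_{m-1}[f;a](t):=\sum_{k=0}^{m-1}\frac{(D^kf)(a)}{k!}(t-a)^k$. A function $f\in C^{m-1}[a,b]$ is called continuously Caputo $\alpha$-differentiable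 if ${}^{C}D_a^{\alpha}f$ exists and belongs to $C[a,b]$. A solution of a Caputo fractional differential equation is a function that is continuously Caputo differentiable of the order of the equation and satisfies the equation; so a solution of (A) is a continuously Caputo $\alpha_k$-differentiable function $x:[a,b]\to\mathbb{R}$ satisfying (A), and a solution of (C) is a vector function whose $j$-th component is continuously Caputo $\beta_j$-differentiable for each $j$ and which satisfies (C). *)

theory Defs
  imports "HOL-Analysis.Analysis"
begin

text \<open>Functions on the interval from \<open>a\<close> to \<open>b\<close> are total functions whose values outside the
  interval are irrelevant; all derivatives are taken within \<open>{a..b}\<close>, hence are one-sided at the
  end points.\<close>

definition nth_deriv :: "real \<Rightarrow> real \<Rightarrow> nat \<Rightarrow> (real \<Rightarrow> real) \<Rightarrow> real \<Rightarrow> real" where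
  "nth_deriv a b m f = ((\<lambda>g t. vector_derivative g (at t within {a..b})) ^^ m) f"

definition times_differentiable :: "real \<Rightarrow> real \<Rightarrow> nat \<Rightarrow> (real \<Rightarrow> real) \<Rightarrow> bool" where
  "times_differentiable a b m f \<longleftrightarrow>
     (\<forall>i<m. \<forall>t\<in>{a..b}. nth_deriv a b i f differentiable (at t within {a..b}))"

definition Cn :: "real \<Rightarrow> real \<Rightarrow> nat \<Rightarrow> (real \<Rightarrow> real) set" where
  "Cn a b m = {f. times_differentiable a b m f \<and> continuous_on {a..b} (nth_deriv a b m f)}"

definition RL_integral :: "real \<Rightarrow> real \<Rightarrow> (real \<Rightarrow> real) \<Rightarrow> real \<Rightarrow> real" where
  "RL_integral a \<alpha> f x =
     (if \<alpha> = 0 then f x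
      else 1 / Gamma \<alpha> * (LINT t:{a..x}|lborel. (x - t) powr (\<alpha> - 1) * f t))"

definition RL_deriv :: "real \<Rightarrow> real \<Rightarrow> real \<Rightarrow> (real \<Rightarrow> real) \<Rightarrow> real \<Rightarrow> real" where
  "RL_deriv a b \<alpha> f = nth_deriv a b (nat \<lceil>\<alpha>\<rceil>) (RL_integral a (real (nat \<lceil>\<alpha>\<rceil>) - \<alpha>) f)"

definition RL_deriv_exists :: "real \<Rightarrow> real \<Rightarrow> real \<Rightarrow> (real \<Rightarrow> real) \<Rightarrow> bool" where
  "RL_deriv_exists a b \<alpha> f \<longleftrightarrow>
     times_differentiable a b (nat \<lceil>\<alpha>\<rceil>) (RL_integral a (real (nat \<lceil>\<alpha>\<rceil>) - \<alpha>) f)"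

text \<open>The Taylor polynomial of degree \<open>m - 1\<close> at \<open>a\<close>.\<close>

definition taylor_poly :: "real \<Rightarrow> real \<Rightarrow> nat \<Rightarrow> (real \<Rightarrow> real) \<Rightarrow> real \<Rightarrow> real" where
  "taylor_poly a b m f t = (\<Sum>k<m. nth_deriv a b k f a / fact k * (t - a) ^ k)"

definition caputo :: "real \<Rightarrow> real \<Rightarrow> real \<Rightarrow> (real \<Rightarrow> real) \<Rightarrow> real \<Rightarrow> real" where
  "caputo a b \<alpha> f = RL_deriv a b \<alpha> (\<lambda>t. f t - taylor_poly a b (nat \<lceil>\<alpha>\<rceil>) f t)"

definition caputo_exists :: "real \<Rightarrow> real \<Rightarrow> real \<Rightarrow> (real \<Rightarrow> real) \<Rightarrow> bool" where
  "caputo_exists a b \<alpha> f \<longleftrightarrow>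
     f \<in> Cn a b (nat \<lceil>\<alpha>\<rceil> - 1) \<and>
     RL_deriv_exists a b \<alpha> (\<lambda>t. f t - taylor_poly a b (nat \<lceil>\<alpha>\<rceil>) f t)"

definition continuously_caputo_differentiable ::
    "real \<Rightarrow> real \<Rightarrow> real \<Rightarrow> (real \<Rightarrow> real) \<Rightarrow> bool" where
  "continuously_caputo_differentiable a b \<alpha> f \<longleftrightarrow>
     caputo_exists a b \<alpha> f \<and> continuous_on {a..b} (caputo a b \<alpha> f)"

text \<open>A point of \<open>\<real>\<close> to the power \<open>k\<close> is an extensional function on \<open>{1..k}\<close>, that is, a point of
  the topological space \<open>powertop_real {1..k}\<close>.\<close>

definition multiterm_vector ::
    "real \<Rightarrow> real \<Rightarrow> (nat \<Rightarrow> real) \<Rightarrow> (real \<Rightarrow> real) \<Rightarrow> nat \<Rightarrow> real \<Rightarrow> real" where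
  "multiterm_vector a b \<alpha> x j = (if j = 1 then x else caputo a b (\<alpha> (j - 1)) x)"

definition multiterm_solution ::
    "real \<Rightarrow> real \<Rightarrow> nat \<Rightarrow> (nat \<Rightarrow> real) \<Rightarrow> (real \<Rightarrow> (nat \<Rightarrow> real) \<Rightarrow> real) \<Rightarrow> (real \<Rightarrow> real) \<Rightarrow> bool" where
  "multiterm_solution a b k \<alpha> f x \<longleftrightarrow>
     continuously_caputo_differentiable a b (\<alpha> k) x \<and>
     (\<forall>t\<in>{a..b}. caputo a b (\<alpha> k) x t = f t (\<lambda>j\<in>{1..k}. multiterm_vector a b \<alpha> x j t))"

definition multiterm_initial ::
    "real \<Rightarrow> real \<Rightarrow> nat \<Rightarrow> (nat \<Rightarrow> real) \<Rightarrow> (nat \<Rightarrow> real) \<Rightarrow> (real \<Rightarrow> real) \<Rightarrow> bool" where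
  "multiterm_initial a b k \<alpha> xa x \<longleftrightarrow> (\<forall>j<nat \<lceil>\<alpha> k\<rceil>. nth_deriv a b j x a = xa j)"

definition system_solution ::
    "real \<Rightarrow> real \<Rightarrow> nat \<Rightarrow> (nat \<Rightarrow> real) \<Rightarrow> (real \<Rightarrow> (nat \<Rightarrow> real) \<Rightarrow> real) \<Rightarrow>
     (nat \<Rightarrow> real \<Rightarrow> real) \<Rightarrow> bool" where
  "system_solution a b k \<beta> f X \<longleftrightarrow>
     (\<forall>j\<in>{1..k}. continuously_caputo_differentiable a b (\<beta> j) (X j)) \<and>
     (\<forall>j\<in>{1..<k}. \<forall>t\<in>{a..b}. caputo a b (\<beta> j) (X j) t = X (j + 1) t) \<and>
     (\<forall>t\<in>{a..b}. caputo a b (\<beta> k) (X k) t = f t (\<lambda>j\<in>{1..k}. X j t))"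

definition system_initial ::
    "real \<Rightarrow> nat \<Rightarrow> (nat \<Rightarrow> real) \<Rightarrow> (nat \<Rightarrow> real) \<Rightarrow> (nat \<Rightarrow> real \<Rightarrow> real) \<Rightarrow> bool" where
  "system_initial a k \<alpha> xa X \<longleftrightarrow>
     (\<forall>j\<in>{1..k}. X j a =
        (if j = 1 then xa 0
         else if \<alpha> (j - 1) \<in> \<nat> then xa (nat \<lfloor>\<alpha> (j - 1)\<rfloor>)
         else 0))"

end

theory Submission
  imports Defs
begin

text \<open>A function \<open>x\<close> has the continuous Caputo derivative \<open>\<phi>\<close> of order \<open>\<alpha>\<close> and the initial values
  \<open>c\<close> if and only if \<open>x = Q + J\<^sup>\<alpha> \<phi>\<close> on the interval, where \<open>Q\<close> is the Taylor polynomial with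
  coefficients \<open>c\<close> and of degree below \<open>\<lceil>\<alpha>\<rceil>\<close>. This follows from the semigroup law
  \<open>J\<^sup>p J\<^sup>q = J\<^sup>p\<^sup>+\<^sup>q\<close> and Taylor's formula with remainder \<open>J\<^sup>n D\<^sup>n\<close>. In this form, increasing the order
  from \<open>\<alpha>\<close> to \<open>\<alpha> + \<beta>\<close> is transparent: if \<open>w = d + J\<^sup>\<beta> z\<close>, then \<open>J\<^sup>\<alpha> w = J\<^sup>\<alpha> d + J\<^sup>\<alpha>\<^sup>+\<^sup>\<beta> z\<close>, and since no
  integer lies strictly between \<open>\<alpha>\<close> and \<open>\<alpha> + \<beta>\<close>, the degree bound changes only for integral \<open>\<alpha>\<close>,
  where \<open>J\<^sup>\<alpha> d\<close> is the missing monomial. The theorem follows by induction along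
  \<open>\<alpha>\<^sub>1 < \<dots> < \<alpha>\<^sub>k\<close>, downwards for the first part and upwards for the second.\<close>

subsection \<open>Riemann--Liouville integrals of continuous functions\<close>

text \<open>The substitution \<open>t = s + (x - s) * u\<close> reduces this to Euler's integral on
  \<open>{0..1}\<close>. Nonnegativity of the integrand turns that gauge integral into a Bochner
  integral, the form that Fubini's theorem requires.\<close>

lemma has_bochner_integral_Beta:
  fixes p q s x :: real
  assumes "0 < p" "0 < q" "s < x"
  shows "has_bochner_integral lborel
           (\<lambda>t. indicator {s..x} t * ((x - t) powr (p - 1) * (t - s) powr (q - 1)))
           (Beta q p * (x - s) powr (p + q - 1))"
proof -
  let ?g = "\<lambda>u::real. indicator {0..1} u * (u powr (q - 1) * (1 - u) powr (p - 1))"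
  have hi: "((\<lambda>u. u powr (q - 1) * (1 - u) powr (p - 1)) has_integral Beta q p) {0..1}"
    using has_integral_Beta_real[of q p] assms by simp
  then have ai: "(\<lambda>u. u powr (q - 1) * (1 - u) powr (p - 1)) absolutely_integrable_on {0..1}"
    by (intro nonnegative_absolutely_integrable_1) auto
  then have "integrable lborel ?g"
    unfolding set_integrable_def by (subst (asm) integrable_completion) auto
  moreover have "integral\<^sup>L lborel ?g = Beta q p"
    using set_lebesgue_integral_eq_integral(2)[OF ai] hi
    by (simp add: set_lebesgue_integral_def integral_completion integral_unique)
  ultimately have g: "has_bochner_integral lborel ?g (Beta q p)"
    by (simp add: has_bochner_integral_iff)
  let ?h = "\<lambda>t. indicator {s..x} t * ((x - t) powr (p - 1) * (t - s) powr (q - 1))"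
  have h: "?h (s + (x - s) * u) = (x - s) powr (p + q - 2) * ?g u" for u
  proof -
    have "indicator {s..x} (s + (x - s) * u) = (indicator {0..1} u :: real)"
    proof -
      have "(x - s) * u \<le> x - s \<longleftrightarrow> u \<le> 1" "0 \<le> (x - s) * u \<longleftrightarrow> 0 \<le> u"
        using assms mult_le_cancel_left_pos[of "x - s" u 1] by (simp_all add: zero_le_mult_iff)
      then have "s \<le> s + (x - s) * u \<and> s + (x - s) * u \<le> x \<longleftrightarrow> 0 \<le> u \<and> u \<le> 1" by linarith
      then show ?thesis unfolding indicator_def by simp
    qed
    moreover have "(x - (s + (x - s) * u)) powr (p - 1) = (x - s) powr (p - 1) * (1 - u) powr (p - 1)"
      if "u \<in> {0..1}"
    proof -
      have "x - (s + (x - s) * u) = (x - s) * (1 - u)" by (simp add: algebra_simps)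
      then show ?thesis using assms that by (simp add: powr_mult)
    qed
    moreover have "(s + (x - s) * u - s) powr (q - 1) = (x - s) powr (q - 1) * u powr (q - 1)"
      if "u \<in> {0..1}"
      using assms that by (simp add: powr_mult)
    moreover have "(x - s) powr (p + q - 2) = (x - s) powr (p - 1) * (x - s) powr (q - 1)"
      by (simp flip: powr_add)
    ultimately show ?thesis
      by (cases "u \<in> {0..1}") (simp_all add: mult_ac)
  qed
  have "has_bochner_integral lborel (\<lambda>u. ?h (s + (x - s) * u)) ((x - s) powr (p + q - 2) * Beta q p)"
    unfolding h by (intro has_bochner_integral_mult_right g)
  \<comment> \<open>The missing factor \<open>x - s\<close> is the Jacobian of the
    substitution.\<close>
  moreover have "(x - s) powr (p + q - 2) * Beta q p
      = (Beta q p * (x - s) powr (p + q - 1)) /\<^sub>R \<bar>x - s\<bar>"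
  proof -
    have *: "(x - s) powr (p + q - 1) = (x - s) powr (p + q - 2) * (x - s)"
      using powr_add[of "x - s" "p + q - 2" 1] assms by simp
    have "P * B = (B * (P * d)) /\<^sub>R \<bar>d\<bar>" if "0 < d" for P B d :: real
      using that by simp
    then show ?thesis using assms unfolding * by (meson diff_gt_0_iff_gt)
  qed
  ultimately have "has_bochner_integral lborel (\<lambda>u. ?h (s + (x - s) * u))
      ((Beta q p * (x - s) powr (p + q - 1)) /\<^sub>R \<bar>x - s\<bar>)"
    by (simp only:)
  moreover have "x - s \<noteq> 0" using assms by simp
  ultimately show ?thesis
    using lborel_has_bochner_integral_real_affine_iff[of "x - s" ?h _ s] by blast
qed

text \<open>A Beta integral whose other exponent is 1. Since \<open>0 powr 0 = 0\<close>, the extra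
  factor equals 1 only off one endpoint, hence the equalities almost everywhere.\<close>

lemma set_integrable_powr_kernel:
  fixes p a x :: real
  assumes "0 < p"
  shows "set_integrable lborel {a..x} (\<lambda>t. (x - t) powr (p - 1))" (is ?R)
    and "set_integrable lborel {a..x} (\<lambda>t. (t - a) powr (p - 1))" (is ?L)
proof -
  have "?R \<and> ?L"
  proof (cases "a < x")
    case True
    have 1: "AE t in lborel. indicator {a..x} t * ((x - t) powr (p - 1) * (t - a) powr (1 - 1)) =
           indicator {a..x} t *\<^sub>R (x - t) powr (p - 1)"
      using AE_lborel_singleton[of a] by eventually_elim (auto simp: indicator_def)
    have 2: "AE t in lborel. indicator {a..x} t * ((x - t) powr (1 - 1) * (t - a) powr (p - 1)) =
           indicator {a..x} t *\<^sub>R (t - a) powr (p - 1)"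
      using AE_lborel_singleton[of x] by eventually_elim (auto simp: indicator_def)
    show ?thesis
      using has_bochner_integral_Beta[OF assms zero_less_one True]
        has_bochner_integral_Beta[OF zero_less_one assms True]
        integrable_cong_AE_imp[OF _ _ 1] integrable_cong_AE_imp[OF _ _ 2]
      by (auto simp: set_integrable_def has_bochner_integral_iff)
  next
    case False
    have "{a..x} = {} \<or> {a..x} = {x}" using False by auto
    then show ?thesis
      by (auto simp: set_integrable_def indicator_def[abs_def] intro: integrable_cong_AE_imp[of _ "\<lambda>_. 0"])
  qed
  then show ?R ?L by auto
qed

text \<open>A continuous \<open>\<phi>\<close> is bounded on the compact interval, so a multiple of
  the kernel dominates.\<close>

lemma set_integrable_powr_kernel_times:
  fixes \<phi> :: "real \<Rightarrow> real"
  assumes "0 < p" "continuous_on {a..x} \<phi>"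
  shows "set_integrable lborel {a..x} (\<lambda>t. (x - t) powr (p - 1) * \<phi> t)"
proof -
  obtain M where "\<forall>y\<in>\<phi> ` {a..x}. norm y \<le> M"
    using compact_imp_bounded[OF compact_continuous_image[OF assms(2) compact_Icc]]
    unfolding bounded_iff by blast
  then have M: "\<bar>\<phi> t\<bar> \<le> M" if "t \<in> {a..x}" for t
    using that by auto
  have [measurable]: "(\<lambda>t. indicator {a..x} t *\<^sub>R \<phi> t) \<in> borel_measurable borel"
    using assms(2) by (intro borel_measurable_continuous_on_indicator) auto
  have "(\<lambda>t. (x - t) powr (p - 1) * (indicator {a..x} t *\<^sub>R \<phi> t)) \<in> borel_measurable lborel"
    by measurable
  then have m: "set_borel_measurable lborel {a..x} (\<lambda>t. (x - t) powr (p - 1) * \<phi> t)"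
    by (simp add: set_borel_measurable_def mult_ac)
  have "set_integrable lborel {a..x} (\<lambda>t. M * (x - t) powr (p - 1))"
    using set_integrable_powr_kernel(1)[OF assms(1)] by simp
  from this m show ?thesis
  proof (rule set_integrable_bound)
    show "AE t in lborel. t \<in> {a..x} \<longrightarrow> norm ((x - t) powr (p - 1) * \<phi> t) \<le> norm (M * (x - t) powr (p - 1))"
    proof (intro AE_I2 impI)
      fix t assume "t \<in> {a..x}"
      then have "\<bar>\<phi> t\<bar> \<le> \<bar>M\<bar>" using M[of t] by linarith
      then show "norm ((x - t) powr (p - 1) * \<phi> t) \<le> norm (M * (x - t) powr (p - 1))"
        by (simp add: abs_mult mult.commute mult_right_mono)
    qed
  qed
qed

section \<open>Elementary rules for the Riemann-Liouville integral\<close>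

lemma RL_integral_cong:
  assumes "\<And>t. t \<in> {a..x} \<Longrightarrow> f t = g t" "a \<le> x"
  shows "RL_integral a p f x = RL_integral a p g x"
  using assms set_lebesgue_integral_cong[of "{a..x}" lborel "\<lambda>t. (x - t) powr (p - 1) * f t"
      "\<lambda>t. (x - t) powr (p - 1) * g t"]
  by (simp add: RL_integral_def)

lemma RL_integral_0 [simp]: "RL_integral a 0 f x = f x"
  by (simp add: RL_integral_def)

text \<open>The interval of integration is a single point, a null set. Order 0 is excluded because
  it yields \<open>f a\<close>.\<close>

lemma RL_integral_left_endpoint:
  assumes "0 < p"
  shows "RL_integral a p f a = 0"
proof -
  have "(LINT t:{a}|lborel. (a - t) powr (p - 1) * f t) = 0"
    unfolding set_lebesgue_integral_def
    by (rule integral_eq_zero_AE)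
      (use AE_lborel_singleton[of a] in \<open>auto simp: indicator_def elim!: eventually_mono\<close>)
  then show ?thesis using assms by (simp add: RL_integral_def)
qed

lemma RL_integral_add:
  assumes "0 \<le> p" "continuous_on {a..x} f" "continuous_on {a..x} g"
  shows "RL_integral a p (\<lambda>t. f t + g t) x = RL_integral a p f x + RL_integral a p g x"
  using set_integral_add(2)[OF set_integrable_powr_kernel_times[of p a x f] set_integrable_powr_kernel_times[of p a x g]] assms
  by (auto simp: RL_integral_def algebra_simps)

lemma RL_integral_cmult:
  "RL_integral a p (\<lambda>t. c * f t) x = c * RL_integral a p f x"
proof -
  have "(LINT t:{a..x}|lborel. (x - t) powr (p - 1) * (c * f t)) =
      c * (LINT t:{a..x}|lborel. (x - t) powr (p - 1) * f t)"
    by (simp add: set_lebesgue_integral_def mult.left_commute[of _ c])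
  then show ?thesis by (simp add: RL_integral_def)
qed

text \<open>Fubini's theorem on the triangle \<open>a \<le> s \<le> t \<le> x\<close>; the inner integral over \<open>t\<close> is a Beta
  integral.\<close>

lemma RL_integral_RL_integral:
  assumes "0 \<le> p" "0 \<le> q" "a \<le> x" "continuous_on {a..x} \<phi>"
  shows "RL_integral a p (RL_integral a q \<phi>) x = RL_integral a (p + q) \<phi> x"
proof (cases "p = 0 \<or> q = 0")
  case True
  have "RL_integral a 0 \<phi> = \<phi>" by auto
  with True show ?thesis by auto
next
  case False
  with assms have p: "0 < p" and q: "0 < q" by auto
  define \<psi> where "\<psi> s = indicator {a..x} s *\<^sub>R \<phi> s" for s
  have [measurable]: "\<psi> \<in> borel_measurable borel"
    unfolding \<psi>_def using assms(4) by (intro borel_measurable_continuous_on_indicator) auto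
  \<comment> \<open>The double integrand, extended by zero to the plane: the condition encodes
    \<open>s \<le> t\<close> and \<open>t \<le> x\<close>, the factor \<open>\<psi> s\<close>
    encodes \<open>a \<le> s\<close>.\<close>
  define h where "h s t = (if s \<le> t \<and> t \<le> x then (x - t) powr (p - 1) * (t - s) powr (q - 1) else 0) * \<psi> s" for s t
  have [measurable]: "case_prod h \<in> borel_measurable (lborel \<Otimes>\<^sub>M lborel)"
    unfolding h_def by measurable
  \<comment> \<open>For \<open>s < x\<close> this is a Beta integral, for \<open>s > x\<close> the
    factor \<open>\<psi> s\<close> vanishes; the single point \<open>s = x\<close> is a null
    set.\<close>
  have hb: "has_bochner_integral lborel (h s) (Beta q p * (x - s) powr (p + q - 1) * \<psi> s)" if "s \<noteq> x" for s
  proof (cases "s < x")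
    case True
    have "h s = (\<lambda>t. indicator {s..x} t * ((x - t) powr (p - 1) * (t - s) powr (q - 1)) * \<psi> s)"
      by (auto simp: h_def indicator_def)
    then show ?thesis
      using has_bochner_integral_mult_left[OF has_bochner_integral_Beta[OF p q True], of "\<psi> s"] by simp
  next
    case False
    with that have "\<psi> s = 0" by (auto simp: \<psi>_def)
    then show ?thesis by (simp add: h_def[abs_def] has_bochner_integral_zero)
  qed
  have hn: "has_bochner_integral lborel (\<lambda>t. norm (h s t)) (Beta q p * (x - s) powr (p + q - 1) * \<bar>\<psi> s\<bar>)" if "s \<noteq> x" for s
  proof (cases "s < x")
    case True
    have "(\<lambda>t. norm (h s t)) = (\<lambda>t. indicator {s..x} t * ((x - t) powr (p - 1) * (t - s) powr (q - 1)) * \<bar>\<psi> s\<bar>)"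
      by (auto simp: h_def indicator_def abs_mult)
    then show ?thesis
      using has_bochner_integral_mult_left[OF has_bochner_integral_Beta[OF p q True], of "\<bar>\<psi> s\<bar>"] by simp
  next
    case False
    with that have "\<psi> s = 0" by (auto simp: \<psi>_def)
    then show ?thesis by (simp add: h_def[abs_def] has_bochner_integral_zero)
  qed
  have pq: "0 < p + q" using p q by simp
  have I: "integrable (lborel \<Otimes>\<^sub>M lborel) (case_prod h)"
  proof (rule lborel_pair.Fubini_integrable)
    show "AE s in lborel. integrable lborel (\<lambda>t. case (s, t) of (s, t) \<Rightarrow> h s t)"
      using AE_lborel_singleton[of x] by eventually_elim (use hb in \<open>auto simp: has_bochner_integral_iff\<close>)
    have "set_integrable lborel {a..x} (\<lambda>s. (x - s) powr (p + q - 1) * \<bar>\<phi> s\<bar>)"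
      using assms(4) pq by (intro set_integrable_powr_kernel_times continuous_intros)
    then have "integrable lborel (\<lambda>s. Beta q p * (indicator {a..x} s *\<^sub>R ((x - s) powr (p + q - 1) * \<bar>\<phi> s\<bar>)))"
      unfolding set_integrable_def by (rule integrable_mult_right)
    then show "integrable lborel (\<lambda>s. LINT t|lborel. norm (case (s, t) of (s, t) \<Rightarrow> h s t))"
    proof (rule integrable_cong_AE_imp)
      show "AE s in lborel. Beta q p * (indicator {a..x} s *\<^sub>R ((x - s) powr (p + q - 1) * \<bar>\<phi> s\<bar>)) =
          (LINT t|lborel. norm (case (s, t) of (s, t) \<Rightarrow> h s t))"
        using AE_lborel_singleton[of x] by eventually_elim
          (use hn in \<open>auto simp: has_bochner_integral_iff \<psi>_def indicator_def\<close>)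
    qed measurable
  qed simp
  have "(LINT t:{a..x}|lborel. (x - t) powr (p - 1) * (LINT s:{a..t}|lborel. (t - s) powr (q - 1) * \<phi> s))
      = (LINT t|lborel. LINT s|lborel. h s t)"
    unfolding set_lebesgue_integral_def
  proof (intro Bochner_Integration.integral_cong refl)
    fix t :: real
    have "(\<lambda>s. h s t) = (\<lambda>s. (indicator {a..x} t * (x - t) powr (p - 1)) * (indicator {a..t} s *\<^sub>R ((t - s) powr (q - 1) * \<phi> s)))"
      by (auto simp: h_def \<psi>_def indicator_def)
    then show "indicator {a..x} t *\<^sub>R ((x - t) powr (p - 1) * (LINT s|lborel. indicator {a..t} s *\<^sub>R ((t - s) powr (q - 1) * \<phi> s)))
        = (LINT s|lborel. h s t)"
      by simp
  qed
  also have "\<dots> = (LINT s|lborel. LINT t|lborel. h s t)"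
    by (rule lborel_pair.Fubini_integral[OF I])
  also have "\<dots> = (LINT s|lborel. Beta q p * (indicator {a..x} s *\<^sub>R ((x - s) powr (p + q - 1) * \<phi> s)))"
  proof (rule integral_cong_AE)
    show "(\<lambda>s. Beta q p * (indicator {a..x} s *\<^sub>R ((x - s) powr (p + q - 1) * \<phi> s))) \<in> borel_measurable lborel"
      using borel_measurable_integrable[OF set_integrable_powr_kernel_times[OF pq assms(4), unfolded set_integrable_def]]
      by measurable
    show "AE s in lborel. (LINT t|lborel. h s t) = Beta q p * (indicator {a..x} s *\<^sub>R ((x - s) powr (p + q - 1) * \<phi> s))"
      using AE_lborel_singleton[of x] by eventually_elim
        (use hb in \<open>auto simp: has_bochner_integral_iff \<psi>_def indicator_def\<close>)
  qed measurable
  also have "\<dots> = Beta q p * (LINT s:{a..x}|lborel. (x - s) powr (p + q - 1) * \<phi> s)"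
    by (simp add: set_lebesgue_integral_def)
  finally have *: "(LINT t:{a..x}|lborel. (x - t) powr (p - 1) * (LINT s:{a..t}|lborel. (t - s) powr (q - 1) * \<phi> s)) = \<dots>" .
  have "(LINT t:{a..x}|lborel. (x - t) powr (p - 1) * RL_integral a q \<phi> t) =
     1 / Gamma q * (LINT t:{a..x}|lborel. (x - t) powr (p - 1) * (LINT s:{a..t}|lborel. (t - s) powr (q - 1) * \<phi> s))"
    using q by (simp add: RL_integral_def[abs_def])
  \<comment> \<open>Nonzero, so that both cancel against
    \<open>Beta q p = Gamma q * Gamma p / Gamma (p + q)\<close> and leave
    \<open>1 / Gamma (p + q)\<close>.\<close>
  moreover have "Gamma p \<noteq> 0" "Gamma q \<noteq> 0"
    using Gamma_real_pos[OF p] Gamma_real_pos[OF q] by auto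
  ultimately show ?thesis
    using p q by (simp add: RL_integral_def[of a p] RL_integral_def[of a "p + q"] * Beta_def add.commute)
qed

text \<open>The substitution \<open>u = x - t\<close> makes the kernel independent of \<open>x\<close>, so that dominated
  convergence applies.\<close>

lemma continuous_on_RL_integral:
  assumes "0 \<le> p" "continuous_on {a..b} \<phi>"
  shows "continuous_on {a..b} (RL_integral a p \<phi>)"
proof (cases "p = 0")
  case True
  then show ?thesis using assms by simp
next
  case False
  with assms have p: "0 < p" by simp
  \<comment> \<open>After the substitution the argument \<open>x - u\<close> moves with
    \<open>x\<close>; a globally continuous extension gives limits for every \<open>u\<close>, even
    where \<open>x - u\<close> leaves the interval.\<close>
  define \<psi> where "\<psi> = ext_cont \<phi> a b"
  have c: "continuous_on UNIV \<psi>" unfolding \<psi>_def using assms by (intro continuous_on_ext_cont) simp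
  then have [measurable]: "\<psi> \<in> borel_measurable borel" by (rule borel_measurable_continuous_onI)
  have eq: "\<psi> t = \<phi> t" if "t \<in> {a..b}" for t using that by (simp add: \<psi>_def)
  have "continuous_on {a..b} (\<lambda>x. LINT u|lborel. indicator {0..x - a} u * (u powr (p - 1) * \<psi> (x - u)))"
  proof (clarsimp simp: continuous_on_sequentially o_def)
    fix X x assume x: "a \<le> x" "x \<le> b" and X: "\<forall>n. a \<le> X n \<and> X n \<le> b" "X \<longlonglongrightarrow> x"
    obtain M where "\<forall>y\<in>\<psi> ` {a..b}. norm y \<le> M"
      using compact_imp_bounded[OF compact_continuous_image[OF continuous_on_subset[OF c] compact_Icc[of a b]]]
      unfolding bounded_iff by blast
    then have M: "\<bar>\<psi> t\<bar> \<le> M" if "t \<in> {a..b}" for t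
      using that by auto
    have M0: "0 \<le> M" using M[of a] x by auto
    let ?F = "\<lambda>x u. indicator {0..x - a} u * (u powr (p - 1) * \<psi> (x - u))"
    show "(\<lambda>n. LINT u|lborel. ?F (X n) u) \<longlonglongrightarrow> (LINT u|lborel. ?F x u)"
    proof (rule integral_dominated_convergence)
      have "set_integrable lborel {0..b - a} (\<lambda>u. u powr (p - 1))"
        using set_integrable_powr_kernel(2)[OF p, of 0] by simp
      then show "integrable lborel (\<lambda>u. M * (indicator {0..b - a} u *\<^sub>R u powr (p - 1)))"
        unfolding set_integrable_def by (rule integrable_mult_right)
      show "AE u in lborel. norm (?F (X n) u) \<le> M * (indicator {0..b - a} u *\<^sub>R u powr (p - 1))" for n
      proof (intro AE_I2)
        fix u
        show "norm (?F (X n) u) \<le> M * (indicator {0..b - a} u *\<^sub>R u powr (p - 1))"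
        proof (cases "u \<in> {0..X n - a}")
          case True
          with X(1) have "X n \<le> b" "X n - u \<in> {a..b}"
            by (auto simp: algebra_simps intro: order_trans[of _ "X n"] dest!: spec[of _ n])
          with True M[of "X n - u"] show ?thesis
            by (simp add: abs_mult mult.commute[of M] mult_left_mono)
        qed (use M0 in \<open>auto simp: indicator_def\<close>)
      qed
      have "isCont \<psi> y" for y using c by (simp add: continuous_on_eq_continuous_at)
      then have lim: "(\<lambda>n. \<psi> (X n - u)) \<longlonglongrightarrow> \<psi> (x - u)" for u
        using X(2) by (intro isCont_tendsto_compose[of _ \<psi>] tendsto_intros) auto
      \<comment> \<open>The indicators settle at every \<open>u\<close> except possibly the limiting
        endpoint \<open>x - a\<close>, a null set.\<close>
      have ind: "eventually (\<lambda>n. ?F (X n) u = indicator {0..x - a} u * (u powr (p - 1) * \<psi> (X n - u))) sequentially"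
        if "u \<noteq> x - a" for u
      proof (cases "u < x - a")
        case True
        then have "eventually (\<lambda>n. a + u < X n) sequentially"
          using X(2) by (intro order_tendstoD(1)[of _ x]) auto
        then show ?thesis by eventually_elim (use True in \<open>auto simp: indicator_def\<close>)
      next
        case False
        with that have "eventually (\<lambda>n. X n < a + u) sequentially"
          using X(2) by (intro order_tendstoD(2)[of _ x]) auto
        then show ?thesis by eventually_elim (use False that in \<open>auto simp: indicator_def\<close>)
      qed
      show "AE u in lborel. (\<lambda>n. ?F (X n) u) \<longlonglongrightarrow> ?F x u"
        using AE_lborel_singleton[of "x - a"]
      proof eventually_elim
        case (elim u)
        show ?case
          using tendsto_cong[OF ind[OF elim]] tendsto_mult[OF tendsto_const tendsto_mult[OF tendsto_const lim]] by fast
      qed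
    qed measurable
  qed
  then have "continuous_on {a..b} (\<lambda>x. 1 / Gamma p * (LINT u|lborel. indicator {0..x - a} u * (u powr (p - 1) * \<psi> (x - u))))"
    by (intro continuous_intros)
  then show ?thesis
  proof (rule continuous_on_eq)
    fix x assume x: "x \<in> {a..b}"
    have "(LINT t:{a..x}|lborel. (x - t) powr (p - 1) * \<phi> t) = (LINT t:{a..x}|lborel. (x - t) powr (p - 1) * \<psi> t)"
      using x eq by (intro set_lebesgue_integral_cong) auto
    also have "\<dots> = (LINT u|lborel. indicator {0..x - a} u * (u powr (p - 1) * \<psi> (x - u)))"
      unfolding set_lebesgue_integral_def
      by (subst lborel_integral_real_affine[of "-1" _ x])
        (auto simp: indicator_def algebra_simps intro!: Bochner_Integration.integral_cong)
    finally show "1 / Gamma p * (LINT u|lborel. indicator {0..x - a} u * (u powr (p - 1) * \<psi> (x - u))) = RL_integral a p \<phi> x"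
      using p by (simp add: RL_integral_def)
  qed
qed

subsection \<open>Taylor expansion with fractional remainder\<close>

text \<open>The factorials make \<open>c l\<close>, for \<open>l < n\<close>, the derivative of
  order \<open>l\<close> at \<open>a\<close>, so that differentiation merely shifts
  \<open>c\<close>.\<close>

definition centered_poly :: "real \<Rightarrow> nat \<Rightarrow> (nat \<Rightarrow> real) \<Rightarrow> real \<Rightarrow> real" where
  "centered_poly a n c t = (\<Sum>l<n. c l / fact l * (t - a) ^ l)"

lemma centered_poly_0 [simp]: "centered_poly a 0 c t = 0"
  by (simp add: centered_poly_def)

lemma centered_poly_Suc: "centered_poly a (Suc n) c t = centered_poly a n c t + c n / fact n * (t - a) ^ n"
  by (simp add: centered_poly_def)

lemma centered_poly_at_center: "0 < n \<Longrightarrow> centered_poly a n c a = c 0"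
  by (cases n) (simp_all add: centered_poly_def sum.lessThan_Suc_shift del: sum.lessThan_Suc)

lemma centered_poly_cong: "(\<And>l. l < n \<Longrightarrow> c l = d l) \<Longrightarrow> centered_poly a n c t = centered_poly a n d t"
  by (simp add: centered_poly_def)

lemma continuous_on_centered_poly [continuous_intros]: "continuous_on S (centered_poly a n c)"
  unfolding centered_poly_def by (intro continuous_intros)

lemma taylor_poly_eq_centered_poly:
  "taylor_poly a b m f t = centered_poly a m (\<lambda>k. nth_deriv a b k f a) t"
  by (simp add: taylor_poly_def centered_poly_def)

lemma centered_poly_has_vector_derivative:
  "(centered_poly a n c has_vector_derivative centered_poly a (n - 1) (\<lambda>l. c (Suc l)) t) (at t within S)"
proof (cases n)
  case (Suc m)
  have "centered_poly a n c = (\<lambda>t. c 0 + (\<Sum>l<m. c (Suc l) / fact (Suc l) * (t - a) ^ Suc l))"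
    by (simp add: centered_poly_def[abs_def] Suc sum.lessThan_Suc_shift del: sum.lessThan_Suc fact_Suc power_Suc)
  moreover have "((\<lambda>t. c 0 + (\<Sum>l<m. c (Suc l) / fact (Suc l) * (t - a) ^ Suc l)) has_real_derivative
      (\<Sum>l<m. c (Suc l) / fact l * (t - a) ^ l)) (at t within S)"
    by (rule derivative_eq_intros refl)+ (simp add: mult.commute)
  ultimately show ?thesis
    by (simp add: has_real_derivative_iff_has_vector_derivative Suc centered_poly_def)
qed (simp add: centered_poly_def[abs_def])

section \<open>Iterated derivatives and integrals of integer order\<close>

lemma nth_deriv_0 [simp]: "nth_deriv a b 0 f = f"
  by (simp add: nth_deriv_def)

lemma nth_deriv_Suc:
  "nth_deriv a b (Suc m) f t = vector_derivative (nth_deriv a b m f) (at t within {a..b})"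
  by (simp add: nth_deriv_def)

lemma nth_deriv_Suc_has_vector_derivative:
  assumes "times_differentiable a b n f" "m < n" "t \<in> {a..b}"
  shows "(nth_deriv a b m f has_vector_derivative nth_deriv a b (Suc m) f t) (at t within {a..b})"
  using assms by (simp add: times_differentiable_def nth_deriv_Suc vector_derivative_works)

text \<open>The kernel is \<open>(x - t) powr 0\<close>, which is 1 except at \<open>t = x\<close>,
  where it is 0.\<close>

lemma RL_integral_1_eq_integral:
  assumes "continuous_on {a..x} \<phi>"
  shows "RL_integral a 1 \<phi> x = integral {a..x} \<phi>"
proof -
  have i: "set_integrable lborel {a..x} \<phi>"
    by (rule borel_integrable_atLeastAtMost'[OF assms])
  have "(LINT t:{a..x}|lborel. (x - t) powr (1 - 1) * \<phi> t) = (LINT t:{a..x}|lborel. \<phi> t)"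
    unfolding set_lebesgue_integral_def
  proof (rule integral_cong_AE)
    show "AE t in lborel. indicator {a..x} t *\<^sub>R ((x - t) powr (1 - 1) * \<phi> t) = indicator {a..x} t *\<^sub>R \<phi> t"
      using AE_lborel_singleton[of x] by eventually_elim (simp add: indicator_def)
  qed (use i set_integrable_powr_kernel_times[OF zero_less_one assms] in
      \<open>auto simp: set_integrable_def dest: borel_measurable_integrable\<close>)
  also have "\<dots> = integral {a..x} \<phi>"
    by (rule set_borel_integral_eq_integral(2)[OF i])
  finally show ?thesis by (simp add: RL_integral_def)
qed

lemma RL_integral_1_of_derivative:
  assumes "\<And>s. s \<in> {a..b} \<Longrightarrow> (F has_vector_derivative f s) (at s within {a..b})"
    and "continuous_on {a..b} f" "t \<in> {a..b}"
  shows "RL_integral a 1 f t = F t - F a"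
proof -
  have "(f has_integral F t - F a) {a..t}"
    using assms by (intro fundamental_theorem_of_calculus)
      (auto intro: has_vector_derivative_within_subset[of _ _ _ "{a..b}"])
  moreover have "continuous_on {a..t} f"
    using assms by (intro continuous_on_subset[OF assms(2)]) auto
  ultimately show ?thesis by (simp add: RL_integral_1_eq_integral integral_unique)
qed

text \<open>Splitting off one integration, \<open>J^(p + 1) = J^1 J^p\<close>, leaves a continuous
  inner function, to which the fundamental theorem of calculus applies.\<close>

lemma RL_integral_has_vector_derivative:
  assumes "continuous_on {a..b} \<phi>" "0 \<le> p" "t \<in> {a..b}"
  shows "(RL_integral a (p + 1) \<phi> has_vector_derivative RL_integral a p \<phi> t) (at t within {a..b})"
proof (rule has_vector_derivative_transform[OF assms(3)])
  have c: "continuous_on {a..b} (RL_integral a p \<phi>)"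
    by (rule continuous_on_RL_integral[OF assms(2,1)])
  then show "((\<lambda>x. integral {a..x} (RL_integral a p \<phi>)) has_vector_derivative RL_integral a p \<phi> t)
      (at t within {a..b})"
    using assms(3) by (rule integral_has_vector_derivative)
  fix x assume x: "x \<in> {a..b}"
  then have "continuous_on {a..x} (RL_integral a p \<phi>)" "continuous_on {a..x} \<phi>"
    by (auto intro: continuous_on_subset[OF c] continuous_on_subset[OF assms(1)])
  then show "RL_integral a (p + 1) \<phi> x = integral {a..x} (RL_integral a p \<phi>)"
    using RL_integral_RL_integral[of 1 p a x \<phi>] RL_integral_1_eq_integral x assms(2)
    by (simp add: add.commute)
qed

text \<open>These are the monomials of Taylor's formula; integrating a constant repeatedly produces
  them one degree at a time.\<close>

lemma RL_integral_const:
  assumes "a \<le> t"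
  shows "RL_integral a (real n) (\<lambda>_. d) t = d / fact n * (t - a) ^ n"
  using assms
proof (induction n arbitrary: t)
  case (Suc n)
  have "RL_integral a (real (Suc n)) (\<lambda>_. d) t = RL_integral a 1 (RL_integral a (real n) (\<lambda>_. d)) t"
    using RL_integral_RL_integral[of 1 "real n" a t "\<lambda>_. d"] Suc.prems by (simp add: add.commute)
  also have "\<dots> = RL_integral a 1 (\<lambda>s. d / fact n * (s - a) ^ n) t"
    using Suc by (intro RL_integral_cong) auto
  also have "\<dots> = d / fact (Suc n) * (t - a) ^ Suc n - d / fact (Suc n) * (a - a) ^ Suc n"
  proof (rule RL_integral_1_of_derivative)
    fix s
    have "((\<lambda>t. d / fact (Suc n) * (t - a) ^ Suc n) has_real_derivative d / fact n * (s - a) ^ n) (at s within {a..t})"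
      by (rule derivative_eq_intros refl)+ simp
    then show "((\<lambda>t. d / fact (Suc n) * (t - a) ^ Suc n) has_vector_derivative d / fact n * (s - a) ^ n) (at s within {a..t})"
      by (simp add: has_real_derivative_iff_has_vector_derivative)
  qed (use Suc.prems in \<open>auto intro!: continuous_intros\<close>)
  finally show ?case by simp
qed simp

section \<open>Derivatives of a polynomial plus a fractional integral, and Taylor's formula\<close>

context
  fixes a b :: real
  assumes ab: "a < b"
begin

text \<open>Each differentiation keeps this form: it shifts the coefficients and lowers the order by
  one. The assumption \<open>a < b\<close> makes derivatives within the interval unique.\<close>

lemma nth_deriv_centered_poly_plus_RL_integral:
  assumes "continuous_on {a..b} \<phi>" "0 \<le> p"
    and "\<And>t. t \<in> {a..b} \<Longrightarrow> f t = centered_poly a n c t + RL_integral a (p + real i) \<phi> t"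
    and "t \<in> {a..b}"
  shows "nth_deriv a b i f t = centered_poly a (n - i) (\<lambda>l. c (l + i)) t + RL_integral a p \<phi> t"
  using assms(2-)
proof (induction i arbitrary: p t)
  case (Suc i)
  have *: "nth_deriv a b i f s = centered_poly a (n - i) (\<lambda>l. c (l + i)) s + RL_integral a (p + 1) \<phi> s"
    if "s \<in> {a..b}" for s
    using that Suc.prems by (intro Suc.IH) (auto simp: add_ac)
  have "((\<lambda>s. centered_poly a (n - i) (\<lambda>l. c (l + i)) s + RL_integral a (p + 1) \<phi> s) has_vector_derivative
      centered_poly a (n - i - 1) (\<lambda>l. c (Suc l + i)) t + RL_integral a p \<phi> t) (at t within {a..b})"
    using Suc.prems assms(1)
    by (intro has_vector_derivative_add RL_integral_has_vector_derivative centered_poly_has_vector_derivative)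
  then have "(nth_deriv a b i f has_vector_derivative
      centered_poly a (n - i - 1) (\<lambda>l. c (Suc l + i)) t + RL_integral a p \<phi> t) (at t within {a..b})"
    using Suc.prems(3) * by (rule has_vector_derivative_transform[rotated 2])
  then show ?case
    using vector_derivative_within_closed_interval[OF ab Suc.prems(3)] by (simp add: nth_deriv_Suc)
qed simp

lemma times_differentiable_centered_poly_plus_RL_integral:
  assumes "continuous_on {a..b} \<phi>" "0 \<le> p"
    and "\<And>t. t \<in> {a..b} \<Longrightarrow> f t = centered_poly a n c t + RL_integral a (p + real i) \<phi> t"
  shows "times_differentiable a b i f"
  unfolding times_differentiable_def
proof (intro allI impI ballI)
  fix j t assume j: "j < i" and t: "t \<in> {a..b}"
  \<comment> \<open>Since \<open>j < i\<close>, an order of at least 1 remains after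
    \<open>j\<close> derivatives, so one more derivative exists.\<close>
  have e: "p + real i = (p + real (i - j - 1) + 1) + real j" using j by simp
  have *: "nth_deriv a b j f s = centered_poly a (n - j) (\<lambda>l. c (l + j)) s + RL_integral a (p + real (i - j - 1) + 1) \<phi> s"
    if "s \<in> {a..b}" for s
    using assms that unfolding e by (intro nth_deriv_centered_poly_plus_RL_integral) auto
  have "((\<lambda>s. centered_poly a (n - j) (\<lambda>l. c (l + j)) s + RL_integral a (p + real (i - j - 1) + 1) \<phi> s) has_vector_derivative
      centered_poly a (n - j - 1) (\<lambda>l. c (Suc l + j)) t + RL_integral a (p + real (i - j - 1)) \<phi> t) (at t within {a..b})"
    using assms(1,2) t
    by (intro has_vector_derivative_add RL_integral_has_vector_derivative centered_poly_has_vector_derivative) auto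
  then have "(nth_deriv a b j f has_vector_derivative
      centered_poly a (n - j - 1) (\<lambda>l. c (Suc l + j)) t + RL_integral a (p + real (i - j - 1)) \<phi> t) (at t within {a..b})"
    using t * by (rule has_vector_derivative_transform[rotated 2])
  then show "nth_deriv a b j f differentiable (at t within {a..b})"
    by (rule differentiableI_vector)
qed

text \<open>In the inductive step the derivative of order \<open>n\<close> is its value at
  \<open>a\<close> plus the integral of the next one; \<open>J^n\<close> turns the constant into the
  next Taylor term, and the semigroup law raises the order of the remainder.\<close>

lemma taylor_RL_integral:
  assumes "f \<in> Cn a b n" "t \<in> {a..b}"
  shows "f t = centered_poly a n (\<lambda>k. nth_deriv a b k f a) t + RL_integral a (real n) (nth_deriv a b n f) t"
  using assms
proof (induction n arbitrary: t)
  case (Suc n)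
  let ?g = "nth_deriv a b n f" and ?g' = "nth_deriv a b (Suc n) f"
  have td: "times_differentiable a b (Suc n) f" and c': "continuous_on {a..b} ?g'"
    using Suc.prems by (auto simp: Cn_def)
  have d: "(?g has_vector_derivative ?g' s) (at s within {a..b})" if "s \<in> {a..b}" for s
    using nth_deriv_Suc_has_vector_derivative[OF td _ that] by simp
  then have c: "continuous_on {a..b} ?g"
    unfolding continuous_on_eq_continuous_within by (intro ballI has_vector_derivative_continuous[OF d])
  have t: "a \<le> t" and ct: "continuous_on {a..t} ?g'"
    using Suc.prems by (auto intro: continuous_on_subset[OF c'])
  have g: "?g s = ?g a + RL_integral a 1 ?g' s" if "s \<in> {a..b}" for s
    using RL_integral_1_of_derivative[OF d c' that] by linarith
  have "f \<in> Cn a b n"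
    using td c unfolding Cn_def times_differentiable_def by simp
  then have "f t = centered_poly a n (\<lambda>k. nth_deriv a b k f a) t + RL_integral a (real n) ?g t"
    using Suc.prems(2) by (rule Suc.IH)
  also have "RL_integral a (real n) ?g t = RL_integral a (real n) (\<lambda>s. ?g a + RL_integral a 1 ?g' s) t"
    by (intro RL_integral_cong g) (use Suc.prems in auto)
  also have "\<dots> = RL_integral a (real n) (\<lambda>s. ?g a) t + RL_integral a (real n) (RL_integral a 1 ?g') t"
    using ct by (intro RL_integral_add continuous_intros continuous_on_RL_integral) auto
  also have "\<dots> = ?g a / fact n * (t - a) ^ n + RL_integral a (real n + 1) ?g' t"
    using t ct by (simp add: RL_integral_const RL_integral_RL_integral)
  finally show ?case by (simp add: centered_poly_Suc add.commute)
qed simp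

subsection \<open>Caputo derivatives and Volterra equations\<close>

text \<open>A continuous function is the Caputo derivative of order \<open>\<alpha>\<close> of a function exactly when it
  solves this Volterra equation; \<open>c\<close> then lists the initial values.\<close>

definition volterra_rep :: "real \<Rightarrow> (real \<Rightarrow> real) \<Rightarrow> (real \<Rightarrow> real) \<Rightarrow> (nat \<Rightarrow> real) \<Rightarrow> bool" where
  "volterra_rep \<alpha> \<phi> f c \<longleftrightarrow> continuous_on {a..b} \<phi> \<and>
     (\<forall>t\<in>{a..b}. f t = centered_poly a (nat \<lceil>\<alpha>\<rceil>) c t + RL_integral a \<alpha> \<phi> t)"

lemma volterra_rep_cong:
  assumes "volterra_rep \<alpha> \<phi> f c"
    and "\<And>t. t \<in> {a..b} \<Longrightarrow> \<phi>' t = \<phi> t" "\<And>t. t \<in> {a..b} \<Longrightarrow> f' t = f t"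
    and "\<And>l. l < nat \<lceil>\<alpha>\<rceil> \<Longrightarrow> c' l = c l"
  shows "volterra_rep \<alpha> \<phi>' f' c'"
proof -
  have "continuous_on {a..b} \<phi>'"
    using assms(1) by (intro continuous_on_eq[of _ \<phi> \<phi>'] assms(2)[symmetric]) (simp_all add: volterra_rep_def)
  moreover have "f' t = centered_poly a (nat \<lceil>\<alpha>\<rceil>) c' t + RL_integral a \<alpha> \<phi>' t" if t: "t \<in> {a..b}" for t
  proof -
    have "RL_integral a \<alpha> \<phi>' t = RL_integral a \<alpha> \<phi> t"
      using t assms(2) by (intro RL_integral_cong) auto
    then show ?thesis
      using assms(1,3) t centered_poly_cong[OF assms(4)] by (simp add: volterra_rep_def)
  qed
  ultimately show ?thesis unfolding volterra_rep_def by blast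
qed

text \<open>Subtracting the Taylor polynomial leaves \<open>J^\<alpha> \<phi>\<close>; applying
  \<open>J^(m - \<alpha>)\<close> gives \<open>J^m \<phi>\<close>, and \<open>m\<close> derivatives
  recover \<open>\<phi>\<close>.\<close>

lemma volterra_rep_imp_caputo:
  assumes "0 < \<alpha>" "volterra_rep \<alpha> \<phi> f c"
  shows "continuously_caputo_differentiable a b \<alpha> f" "t \<in> {a..b} \<Longrightarrow> caputo a b \<alpha> f t = \<phi> t"
    "l < nat \<lceil>\<alpha>\<rceil> \<Longrightarrow> nth_deriv a b l f a = c l"
proof -
  define m where "m = nat \<lceil>\<alpha>\<rceil>"
  have m: "0 < m" "real m - 1 < \<alpha>" "\<alpha> \<le> real m"
    using assms(1) unfolding m_def by linarith+
  have c: "continuous_on {a..b} \<phi>"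
    and f: "\<And>t. t \<in> {a..b} \<Longrightarrow> f t = centered_poly a m c t + RL_integral a \<alpha> \<phi> t"
    using assms(2) by (auto simp: volterra_rep_def m_def)
  have cx: "continuous_on {a..x} \<phi>" if "x \<in> {a..b}" for x
    using that by (auto intro: continuous_on_subset[OF c])
  have D: "nth_deriv a b l f t = centered_poly a (m - l) (\<lambda>i. c (i + l)) t + RL_integral a (\<alpha> - real l) \<phi> t"
    if "l < m" "t \<in> {a..b}" for l t
    using that m f c by (intro nth_deriv_centered_poly_plus_RL_integral) auto
  \<comment> \<open>For \<open>l < m\<close> the remaining order \<open>\<alpha> - l\<close> is
    positive, so the integral vanishes at \<open>a\<close>.\<close>
  have init: "nth_deriv a b l f a = c l" if "l < m" for l
    using that D[of l a] ab m by (simp add: centered_poly_at_center RL_integral_left_endpoint)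
  let ?g = "\<lambda>t. f t - taylor_poly a b m f t"
  have "?g t = RL_integral a \<alpha> \<phi> t" if "t \<in> {a..b}" for t
    using f[OF that] init by (simp add: taylor_poly_eq_centered_poly cong: centered_poly_cong)
  then have g: "RL_integral a (real m - \<alpha>) ?g t = RL_integral a (real m) \<phi> t" if t: "t \<in> {a..b}" for t
    using t m assms(1) cx[OF t] RL_integral_RL_integral[of "real m - \<alpha>" \<alpha> a t \<phi>]
      RL_integral_cong[of a t ?g "RL_integral a \<alpha> \<phi>" "real m - \<alpha>"] by simp
  have cap: "caputo a b \<alpha> f t = \<phi> t" if t: "t \<in> {a..b}" for t
    using nth_deriv_centered_poly_plus_RL_integral[where n = 0 and p = 0 and i = m, OF c _ _ t] g
    by (simp add: caputo_def RL_deriv_def flip: m_def)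
  have "times_differentiable a b m (RL_integral a (real m - \<alpha>) ?g)"
    using g by (intro times_differentiable_centered_poly_plus_RL_integral[where n = 0 and p = 0 and i = m, OF c]) auto
  moreover have "times_differentiable a b (m - 1) f"
    using f m by (intro times_differentiable_centered_poly_plus_RL_integral[where p = "\<alpha> - real (m - 1)", OF c])
      (auto simp: of_nat_diff)
  moreover have "continuous_on {a..b} (nth_deriv a b (m - 1) f)"
  proof (rule continuous_on_eq)
    show "continuous_on {a..b} (\<lambda>t. centered_poly a (m - (m - 1)) (\<lambda>i. c (i + (m - 1))) t + RL_integral a (\<alpha> - real (m - 1)) \<phi> t)"
      using m c by (intro continuous_intros continuous_on_RL_integral) (auto simp: of_nat_diff)
  qed (use D[of "m - 1"] m in auto)
  ultimately have "caputo_exists a b \<alpha> f"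
    by (simp add: caputo_exists_def Cn_def RL_deriv_exists_def flip: m_def)
  then show "continuously_caputo_differentiable a b \<alpha> f"
    using continuous_on_eq[OF c cap[symmetric]] by (simp add: continuously_caputo_differentiable_def)
  show "t \<in> {a..b} \<Longrightarrow> caputo a b \<alpha> f t = \<phi> t" by (rule cap)
  show "l < nat \<lceil>\<alpha>\<rceil> \<Longrightarrow> nth_deriv a b l f a = c l" using init by (simp add: m_def)
qed

text \<open>By Taylor's formula \<open>f\<close> minus its polynomial is \<open>J^n h\<close>, and
  the Caputo derivative is the derivative of \<open>J^\<gamma> h\<close>. Abel inversion, that is,
  applying \<open>J^(1 - \<gamma>)\<close> and differentiating, expresses \<open>h\<close> through
  the Caputo derivative.\<close>

lemma caputo_imp_volterra_rep:
  assumes "0 < \<alpha>" "continuously_caputo_differentiable a b \<alpha> f"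
  shows "volterra_rep \<alpha> (caputo a b \<alpha> f) f (\<lambda>l. nth_deriv a b l f a)"
proof -
  let ?\<phi> = "caputo a b \<alpha> f" and ?c = "\<lambda>l. nth_deriv a b l f a"
  define n where "n = nat \<lceil>\<alpha>\<rceil> - 1"
  have m: "nat \<lceil>\<alpha>\<rceil> = Suc n" using assms(1) unfolding n_def by linarith
  define \<gamma> where "\<gamma> = real (Suc n) - \<alpha>"
  have \<gamma>: "0 \<le> \<gamma>" "\<gamma> < 1" using m unfolding \<gamma>_def by linarith+
  let ?g = "\<lambda>t. f t - taylor_poly a b (Suc n) f t"
  have Cn: "f \<in> Cn a b n" and td: "times_differentiable a b (Suc n) (RL_integral a \<gamma> ?g)"
    and c: "continuous_on {a..b} ?\<phi>"
    using assms(2) by (auto simp: continuously_caputo_differentiable_def caputo_exists_def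
        RL_deriv_exists_def m \<gamma>_def)
  have \<phi>: "?\<phi> = nth_deriv a b (Suc n) (RL_integral a \<gamma> ?g)"
    by (simp add: caputo_def RL_deriv_def m \<gamma>_def)
  \<comment> \<open>Subtracting the value at \<open>a\<close> absorbs the Taylor term of degree
    \<open>n\<close> and gives \<open>h a = 0\<close>, so that \<open>J^\<gamma> h\<close> vanishes
    at \<open>a\<close> even for \<open>\<gamma> = 0\<close>.\<close>
  define h where "h t = nth_deriv a b n f t - ?c n" for t
  have ch: "continuous_on {a..b} h"
    using Cn unfolding h_def by (intro continuous_intros) (simp add: Cn_def)
  have cx: "continuous_on {a..x} h" "continuous_on {a..x} ?\<phi>" if "x \<in> {a..b}" for x
    using that by (auto intro: continuous_on_subset[OF c] continuous_on_subset[OF ch])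
  have f: "f t = centered_poly a (Suc n) ?c t + RL_integral a (real n) h t" if t: "t \<in> {a..b}" for t
  proof -
    have "RL_integral a (real n) (nth_deriv a b n f) t = RL_integral a (real n) (\<lambda>s. h s + ?c n) t"
      by (simp add: h_def)
    also have "\<dots> = RL_integral a (real n) h t + ?c n / fact n * (t - a) ^ n"
      using t cx[OF t] by (simp add: RL_integral_add RL_integral_const)
    finally show ?thesis
      using taylor_RL_integral[OF Cn t] by (simp add: centered_poly_Suc)
  qed
  have G: "RL_integral a \<gamma> ?g t = RL_integral a (\<gamma> + real n) h t" if t: "t \<in> {a..b}" for t
  proof -
    have "RL_integral a \<gamma> ?g t = RL_integral a \<gamma> (RL_integral a (real n) h) t"
      using t f by (intro RL_integral_cong) (auto simp: taylor_poly_eq_centered_poly)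
    then show ?thesis using t cx[OF t] \<gamma> by (simp add: RL_integral_RL_integral)
  qed
  have Gn: "nth_deriv a b n (RL_integral a \<gamma> ?g) t = RL_integral a \<gamma> h t" if "t \<in> {a..b}" for t
    using nth_deriv_centered_poly_plus_RL_integral[where n = 0, OF ch \<gamma>(1) _ that] G by simp
  have "(RL_integral a \<gamma> h has_vector_derivative ?\<phi> t) (at t within {a..b})" if t: "t \<in> {a..b}" for t
  proof (rule has_vector_derivative_transform[OF t])
    show "(nth_deriv a b n (RL_integral a \<gamma> ?g) has_vector_derivative ?\<phi> t) (at t within {a..b})"
      unfolding \<phi> by (rule nth_deriv_Suc_has_vector_derivative[OF td _ t]) simp
  qed (simp add: Gn)
  moreover have "RL_integral a \<gamma> h a = 0"
    using \<gamma> by (cases "\<gamma> = 0") (simp_all add: RL_integral_left_endpoint h_def)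
  ultimately have 1: "RL_integral a 1 ?\<phi> t = RL_integral a \<gamma> h t" if "t \<in> {a..b}" for t
    using RL_integral_1_of_derivative[where F = "RL_integral a \<gamma> h", OF _ c that] by simp
  \<comment> \<open>Applying \<open>J^(1 - \<gamma>)\<close> to both sides of \<open>1\<close>
    completes the order \<open>\<gamma>\<close> to 1.\<close>
  have 2: "RL_integral a 1 h t = RL_integral a (1 - \<gamma> + 1) ?\<phi> t" if t: "t \<in> {a..b}" for t
  proof -
    have "RL_integral a (1 - \<gamma>) (RL_integral a \<gamma> h) t = RL_integral a (1 - \<gamma>) (RL_integral a 1 ?\<phi>) t"
      using t 1 by (intro RL_integral_cong) auto
    then show ?thesis
      using t cx[OF t] \<gamma> by (simp add: RL_integral_RL_integral)
  qed
  \<comment> \<open>Both sides of \<open>2\<close> are differentiated and compared.\<close>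
  have 3: "h t = RL_integral a (1 - \<gamma>) ?\<phi> t" if t: "t \<in> {a..b}" for t
  proof -
    have "(RL_integral a (1 - \<gamma> + 1) ?\<phi> has_vector_derivative RL_integral a (1 - \<gamma>) ?\<phi> t) (at t within {a..b})"
      using c \<gamma> t by (intro RL_integral_has_vector_derivative) auto
    then have "(RL_integral a 1 h has_vector_derivative RL_integral a (1 - \<gamma>) ?\<phi> t) (at t within {a..b})"
      using 2 by (rule has_vector_derivative_transform[OF t, rotated]) 
    moreover have "(RL_integral a 1 h has_vector_derivative h t) (at t within {a..b})"
      using RL_integral_has_vector_derivative[OF ch order_refl t] by simp
    ultimately show ?thesis
      by (rule trans[OF sym[OF vector_derivative_within_closed_interval[OF ab t]]
            vector_derivative_within_closed_interval[OF ab t], rotated])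
  qed
  have "RL_integral a (real n) h t = RL_integral a \<alpha> ?\<phi> t" if t: "t \<in> {a..b}" for t
  proof -
    have "RL_integral a (real n) h t = RL_integral a (real n) (RL_integral a (1 - \<gamma>) ?\<phi>) t"
      using t 3 by (intro RL_integral_cong) auto
    also have "\<dots> = RL_integral a (real n + (1 - \<gamma>)) ?\<phi> t"
      using t cx[OF t] \<gamma> by (simp add: RL_integral_RL_integral)
    finally show ?thesis by (simp add: \<gamma>_def)
  qed
  then show ?thesis using f c by (simp add: volterra_rep_def m)
qed

text \<open>If \<open>\<alpha>\<close> is an integer \<open>m\<close>, the left polynomial lacks the term of degree \<open>m\<close>; it is the
  fractional integral of order \<open>m\<close> of the constant \<open>d\<close>. Otherwise both polynomials agree.\<close>

lemma centered_poly_plus_RL_integral_step: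
  assumes "0 < \<alpha>" "0 < \<beta>" "\<not> (\<exists>n::int. \<alpha> < of_int n \<and> of_int n < \<alpha> + \<beta>)"
    and "continuous_on {a..b} z" "t \<in> {a..b}"
    and d: "d = (if \<alpha> \<in> \<nat> then c (nat \<lfloor>\<alpha>\<rfloor>) else 0)"
  shows "centered_poly a (nat \<lceil>\<alpha>\<rceil>) c t + RL_integral a \<alpha> (\<lambda>s. d + RL_integral a \<beta> z s) t =
    centered_poly a (nat \<lceil>\<alpha> + \<beta>\<rceil>) c t + RL_integral a (\<alpha> + \<beta>) z t"
proof -
  have cz: "continuous_on {a..t} z" and t: "a \<le> t"
    using assms(4,5) by (auto intro: continuous_on_subset)
  have *: "RL_integral a \<alpha> (\<lambda>s. d + RL_integral a \<beta> z s) t = RL_integral a \<alpha> (\<lambda>_. d) t + RL_integral a (\<alpha> + \<beta>) z t"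
    using assms(1,2) cz t
    by (simp add: RL_integral_add continuous_on_RL_integral RL_integral_RL_integral)
  show ?thesis
  proof (cases "\<alpha> \<in> \<nat>")
    case True
    then obtain m where m: "\<alpha> = real m" by (auto elim: Nats_cases)
    \<comment> \<open>The integer \<open>m + 1\<close> exceeds \<open>\<alpha>\<close>, so it cannot
      lie below \<open>\<alpha> + \<beta>\<close>; the degree bound grows by exactly one.\<close>
    have "\<not> real m + 1 < \<alpha> + \<beta>"
      using assms(3)[simplified, rule_format, of "int m + 1"] m by simp
    then have "\<lceil>\<alpha> + \<beta>\<rceil> = int m + 1" using m assms(2) by (intro ceiling_unique) auto
    then have "nat \<lceil>\<alpha> + \<beta>\<rceil> = Suc m" by simp
    moreover have dm: "d = c m" using True by (simp add: d m)
    ultimately show ?thesis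
      using RL_integral_const[OF t, of m d] *[unfolded m] by (simp add: m dm centered_poly_Suc)
  next
    case False
    \<comment> \<open>Here \<open>\<alpha>\<close> lies strictly below its ceiling, which
      \<open>\<alpha> + \<beta>\<close> therefore cannot pass: both degree bounds agree.\<close>
    have "\<alpha> \<noteq> of_int \<lceil>\<alpha>\<rceil>"
    proof
      assume e: "\<alpha> = of_int \<lceil>\<alpha>\<rceil>"
      then have "\<alpha> = real (nat \<lceil>\<alpha>\<rceil>)" using assms(1) by simp
      then show False using False by (metis of_nat_in_Nats)
    qed
    then have "\<alpha> < of_int \<lceil>\<alpha>\<rceil>" using le_of_int_ceiling[of \<alpha>] by linarith
    then have "\<alpha> + \<beta> \<le> of_int \<lceil>\<alpha>\<rceil>" using assms(3) by force
    then have "\<lceil>\<alpha> + \<beta>\<rceil> = \<lceil>\<alpha>\<rceil>"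
      using assms(2) by (intro ceiling_unique) linarith+
    moreover have "RL_integral a \<alpha> (\<lambda>_. d) t = 0"
      using RL_integral_cmult[of a \<alpha> 0 "\<lambda>_. 0" t] False by (simp add: d)
    ultimately show ?thesis by (simp add: *)
  qed
qed

text \<open>The function \<open>d + J^\<beta> z\<close> represents \<open>x\<close> at order
  \<open>\<alpha>\<close>, so it must be the Caputo derivative of that order; its formula is already
  a representation of order \<open>\<beta>\<close>.\<close>

lemma volterra_rep_split:
  assumes "0 < \<alpha>" "0 < \<beta>" "\<beta> \<le> 1" "\<not> (\<exists>n::int. \<alpha> < of_int n \<and> of_int n < \<alpha> + \<beta>)"
    and d: "d = (if \<alpha> \<in> \<nat> then c (nat \<lfloor>\<alpha>\<rfloor>) else 0)"
    and "volterra_rep (\<alpha> + \<beta>) z x c"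
  shows "volterra_rep \<alpha> (caputo a b \<alpha> x) x c" "volterra_rep \<beta> z (caputo a b \<alpha> x) (\<lambda>_. d)"
proof -
  let ?w = "\<lambda>s. d + RL_integral a \<beta> z s"
  have z: "continuous_on {a..b} z" and x: "\<And>t. t \<in> {a..b} \<Longrightarrow>
      x t = centered_poly a (nat \<lceil>\<alpha> + \<beta>\<rceil>) c t + RL_integral a (\<alpha> + \<beta>) z t"
    using assms(6) by (auto simp: volterra_rep_def)
  have "continuous_on {a..b} ?w"
    using assms(2) z by (intro continuous_intros continuous_on_RL_integral) auto
  then have w: "volterra_rep \<alpha> ?w x c"
    unfolding volterra_rep_def
    by (intro conjI ballI trans[OF x centered_poly_plus_RL_integral_step[where c = c, OF assms(1,2,4) z _ d, symmetric]])
  note cap = volterra_rep_imp_caputo(2)[OF assms(1) w]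
  show "volterra_rep \<alpha> (caputo a b \<alpha> x) x c"
    using w cap by (rule volterra_rep_cong) auto
  \<comment> \<open>Order \<open>\<beta>\<close> admits one initial value, so its polynomial is the
    constant \<open>d\<close>.\<close>
  have "\<lceil>\<beta>\<rceil> = 1" using assms(2,3) by (intro ceiling_unique) auto
  then show "volterra_rep \<beta> z (caputo a b \<alpha> x) (\<lambda>_. d)"
    using z cap by (simp add: volterra_rep_def centered_poly_def)
qed

text \<open>The converse of the splitting: the representation of \<open>w\<close> is substituted
  into that of \<open>x\<close>, and \<open>d\<close> supplies the monomial that may be
  missing.\<close>

lemma volterra_rep_compose:
  assumes "0 < \<alpha>" "0 < \<beta>" "\<beta> \<le> 1" "\<not> (\<exists>n::int. \<alpha> < of_int n \<and> of_int n < \<alpha> + \<beta>)"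
    and d: "d = (if \<alpha> \<in> \<nat> then c (nat \<lfloor>\<alpha>\<rfloor>) else 0)"
    and "volterra_rep \<alpha> w x c" "volterra_rep \<beta> z w (\<lambda>_. d)"
  shows "volterra_rep (\<alpha> + \<beta>) z x c"
proof -
  have "\<lceil>\<beta>\<rceil> = 1" using assms(2,3) by (intro ceiling_unique) auto
  then have z: "continuous_on {a..b} z" and w: "\<And>t. t \<in> {a..b} \<Longrightarrow> d + RL_integral a \<beta> z t = w t"
    using assms(7) by (auto simp: volterra_rep_def centered_poly_def)
  have "volterra_rep \<alpha> (\<lambda>t. d + RL_integral a \<beta> z t) x c"
    using assms(6) w by (rule volterra_rep_cong) auto
  then show ?thesis
    unfolding volterra_rep_def
    by (intro conjI z ballI trans[OF _ centered_poly_plus_RL_integral_step[where c = c, OF assms(1,2,4) z _ d]]) auto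
qed

end

subsection \<open>Equivalence of the equation and the system\<close>

text \<open>Since \<open>caputo\<close> is a total function, existence of the intermediate
  derivatives is claimed separately through \<open>caputo_exists\<close>.\<close>

theorem theorem15:
  fixes a b :: real and k :: nat and \<alpha> \<beta> :: "nat \<Rightarrow> real"
    and f :: "real \<Rightarrow> (nat \<Rightarrow> real) \<Rightarrow> real" and xa :: "nat \<Rightarrow> real"
  assumes "a < b"
    and "k \<ge> 1"
    and "0 < \<alpha> 1" and "\<alpha> 1 \<le> 1"
    and "\<And>j. j \<in> {2..k} \<Longrightarrow> \<alpha> (j - 1) < \<alpha> j"
    and "\<And>j. j \<in> {2..k} \<Longrightarrow> \<alpha> j - \<alpha> (j - 1) \<le> 1"
    and "\<And>j. j \<in> {2..k} \<Longrightarrow> \<not> (\<exists>n::int. \<alpha> (j - 1) < of_int n \<and> of_int n < \<alpha> j)"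
    and "continuous_map (prod_topology (top_of_set {a..b}) (powertop_real {1..k}))
           euclideanreal (\<lambda>(t, u). f t u)"
    and "\<beta> 1 = \<alpha> 1"
    and "\<And>j. j \<in> {2..k} \<Longrightarrow> \<beta> j = \<alpha> j - \<alpha> (j - 1)"
  shows "(\<forall>x. multiterm_solution a b k \<alpha> f x \<and> multiterm_initial a b k \<alpha> xa x \<longrightarrow>
            (\<forall>j\<in>{1..<k}. caputo_exists a b (\<alpha> j) x) \<and>
            system_solution a b k \<beta> f (multiterm_vector a b \<alpha> x) \<and>
            system_initial a k \<alpha> xa (multiterm_vector a b \<alpha> x)) \<and>
         (\<forall>X. system_solution a b k \<beta> f X \<and> system_initial a k \<alpha> xa X \<longrightarrow>
            (\<forall>j\<in>{1..<k}. caputo_exists a b (\<alpha> j) (X 1)) \<and>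
            multiterm_solution a b k \<alpha> f (X 1) \<and>
            multiterm_initial a b k \<alpha> xa (X 1))"
proof -
  note ab = \<open>a < b\<close>
  have pos: "0 < \<alpha> j" if "j \<in> {1..k}" for j
    using that
  proof (induction j)
    case (Suc j)
    show ?case
    proof (cases "j = 0")
      case False
      then show ?thesis using Suc assms(5)[of "Suc j"] by simp
    qed (use assms(3) in simp)
  qed simp
  have diff: "0 < \<beta> (Suc j)" "\<beta> (Suc j) \<le> 1" "\<alpha> (Suc j) = \<alpha> j + \<beta> (Suc j)"
    "\<not> (\<exists>n::int. \<alpha> j < of_int n \<and> of_int n < \<alpha> j + \<beta> (Suc j))" if "1 \<le> j" "j < k" for j
    using assms(5,6,7,10)[of "Suc j"] that by auto
  have \<beta>_pos: "0 < \<beta> j" if "j \<in> {1..k}" for j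
    using that diff(1)[of "j - 1"] assms(3,9) by (cases "j = 1") auto
  have \<beta>_ceil: "\<lceil>\<beta> j\<rceil> = 1" if "j \<in> {1..k}" for j
    using that diff(2)[of "j - 1"] \<beta>_pos[OF that] assms(4,9)
    by (intro ceiling_unique; cases "j = 1") auto
  \<comment> \<open>\<open>d j\<close> is the initial value prescribed for the component of index
    \<open>j + 1\<close>.\<close>
  define d where "d j = (if j = 0 then xa 0 else if \<alpha> j \<in> \<nat> then xa (nat \<lfloor>\<alpha> j\<rfloor>) else 0)" for j
  have k: "k \<in> {1..k}" using assms(2) by simp
  have initial_iff: "system_initial a k \<alpha> xa X \<longleftrightarrow> (\<forall>j\<in>{1..k}. X j a = d (j - 1))" for X
    unfolding system_initial_def by (intro ball_cong) (auto simp: d_def)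

  \<comment> \<open>From the equation to the system\<close>
  have part1: "(\<forall>j\<in>{1..<k}. caputo_exists a b (\<alpha> j) x) \<and>
      system_solution a b k \<beta> f (multiterm_vector a b \<alpha> x) \<and>
      system_initial a k \<alpha> xa (multiterm_vector a b \<alpha> x)"
    if sol: "multiterm_solution a b k \<alpha> f x" and init: "multiterm_initial a b k \<alpha> xa x" for x
  proof -
    let ?X = "multiterm_vector a b \<alpha> x"
    \<comment> \<open>Downward from order \<open>\<alpha> k\<close>: every lower order inherits the
      coefficients \<open>xa\<close>, and the representation yields existence of the corresponding
      Caputo derivative.\<close>
    have rep: "volterra_rep a b (\<alpha> j) (caputo a b (\<alpha> j) x) x xa" if "j \<in> {1..k}" for j
    proof -
      from that have "j \<le> k" "1 \<le> j" by auto
      then show ?thesis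
      proof (induction rule: inc_induct)
        case base
        have "volterra_rep a b (\<alpha> k) (caputo a b (\<alpha> k) x) x (\<lambda>l. nth_deriv a b l x a)"
          using sol pos[OF k] by (intro caputo_imp_volterra_rep ab) (auto simp: multiterm_solution_def)
        then show ?case
          by (rule volterra_rep_cong[OF ab]) (use init in \<open>auto simp: multiterm_initial_def\<close>)
      next
        case (step n)
        then have n: "1 \<le> n" "n < k" and "volterra_rep a b (\<alpha> n + \<beta> (Suc n)) (caputo a b (\<alpha> (Suc n)) x) x xa"
          using diff(3)[of n] by auto
        then show ?case
          using volterra_rep_split(1)[OF ab pos diff(1,2,4)[OF n] refl] by simp
      qed
    qed
    \<comment> \<open>For \<open>j \<ge> 2\<close> this comes from splitting
      \<open>\<alpha> j\<close> into \<open>\<alpha> (j - 1)\<close> and \<open>\<beta> j\<close>;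
      for \<open>j = 1\<close> it is \<open>rep\<close>, where only the coefficient of index 0 is
      read.\<close>
    have rep_X: "volterra_rep a b (\<beta> j) (caputo a b (\<alpha> j) x) (?X j) (\<lambda>_. d (j - 1))" if j: "j \<in> {1..k}" for j
    proof (cases "j = 1")
      case True
      have "volterra_rep a b (\<beta> 1) (caputo a b (\<alpha> 1) x) x xa"
        using rep[OF j] True assms(9) by simp
      then have "volterra_rep a b (\<beta> 1) (caputo a b (\<alpha> 1) x) x (\<lambda>_. d 0)"
        by (rule volterra_rep_cong[OF ab]) (use \<beta>_ceil[of 1] assms(2) in \<open>simp_all add: d_def\<close>)
      then show ?thesis using True by (simp add: multiterm_vector_def)
    next
      case False
      then obtain i where i: "j = Suc i" "1 \<le> i" "i < k" using j by (cases j) auto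
      have "volterra_rep a b (\<alpha> i + \<beta> (Suc i)) (caputo a b (\<alpha> (Suc i)) x) x xa"
        using rep[OF j] i diff(3)[of i] by simp
      then show ?thesis
        using volterra_rep_split(2)[OF ab pos diff(1,2,4)[OF i(2,3)], of "d i" xa] i
        by (simp add: multiterm_vector_def d_def)
    qed
    note X = volterra_rep_imp_caputo[OF ab \<beta>_pos rep_X]
    have "?X j a = d (j - 1)" if "j \<in> {1..k}" for j
      using X(3)[OF that that, of 0] \<beta>_ceil[OF that] by simp
    then have "system_initial a k \<alpha> xa ?X" by (simp add: initial_iff)
    moreover have "system_solution a b k \<beta> f ?X"
      using X(1,2) k sol unfolding system_solution_def multiterm_solution_def
      by (auto simp: multiterm_vector_def)
    moreover have "caputo_exists a b (\<alpha> j) x" if "j \<in> {1..<k}" for j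
      using volterra_rep_imp_caputo(1)[OF ab pos rep, of j] that
      by (simp add: continuously_caputo_differentiable_def)
    ultimately show ?thesis by blast
  qed

  \<comment> \<open>From the system to the equation\<close>
  have part2: "(\<forall>j\<in>{1..<k}. caputo_exists a b (\<alpha> j) (X 1)) \<and>
      multiterm_solution a b k \<alpha> f (X 1) \<and> multiterm_initial a b k \<alpha> xa (X 1)"
    if sol: "system_solution a b k \<beta> f X" and init: "system_initial a k \<alpha> xa X" for X
  proof -
    have rep_X: "volterra_rep a b (\<beta> j) (caputo a b (\<beta> j) (X j)) (X j) (\<lambda>_. d (j - 1))" if j: "j \<in> {1..k}" for j
    proof -
      have "volterra_rep a b (\<beta> j) (caputo a b (\<beta> j) (X j)) (X j) (\<lambda>l. nth_deriv a b l (X j) a)"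
        using sol j by (intro caputo_imp_volterra_rep ab \<beta>_pos) (auto simp: system_solution_def)
      then show ?thesis
        by (rule volterra_rep_cong[OF ab]) (use init j \<beta>_ceil[OF j] in \<open>auto simp: initial_iff\<close>)
    qed
    have next_X: "caputo a b (\<beta> j) (X j) t = X (Suc j) t" if "1 \<le> j" "j < k" "t \<in> {a..b}" for j t
      using sol that by (simp add: system_solution_def)
    \<comment> \<open>Upward along the orders: \<open>X (Suc n)\<close> is the integrand
      representing \<open>X 1\<close> at order \<open>\<alpha> n\<close>, and its own representation
      raises the order by \<open>\<beta> (Suc n)\<close>.\<close>
    have rep: "volterra_rep a b (\<alpha> j) (caputo a b (\<beta> j) (X j)) (X 1) xa" if "j \<in> {1..k}" for j
    proof -
      from that have "1 \<le> j" "j \<le> k" by auto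
      then show ?thesis
      proof (induction rule: dec_induct)
        case base
        have "volterra_rep a b (\<alpha> 1) (caputo a b (\<beta> 1) (X 1)) (X 1) (\<lambda>_. d 0)"
          using rep_X[of 1] assms(2,9) by simp
        then show ?case
          by (rule volterra_rep_cong[OF ab]) (use \<beta>_ceil[of 1] assms(2,9) in \<open>simp_all add: d_def\<close>)
      next
        case (step n)
        then have n: "1 \<le> n" "n < k" by auto
        have "volterra_rep a b (\<alpha> n) (X (Suc n)) (X 1) xa"
          using step.IH by (rule volterra_rep_cong[OF ab]) (use n next_X in simp_all)
        moreover have "volterra_rep a b (\<beta> (Suc n)) (caputo a b (\<beta> (Suc n)) (X (Suc n))) (X (Suc n)) (\<lambda>_. d n)"
          using rep_X[of "Suc n"] n by simp
        ultimately show ?case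
          using volterra_rep_compose[OF ab pos diff(1,2,4)[OF n], of "d n" xa] n diff(3)[OF n] by (simp add: d_def)
      qed
    qed
    note x = volterra_rep_imp_caputo[OF ab pos rep]
    \<comment> \<open>The components agree on the interval, where the equation evaluates them;
      outside it the total functions may differ.\<close>
    have vec: "multiterm_vector a b \<alpha> (X 1) j t = X j t" if j: "j \<in> {1..k}" and t: "t \<in> {a..b}" for j t
    proof (cases "j = 1")
      case False
      then obtain i where "j = Suc i" "1 \<le> i" "i < k" using j False by (cases j) auto
      then show ?thesis
        using t x(2)[of i t] next_X[of i t] by (simp add: multiterm_vector_def)
    qed (simp add: multiterm_vector_def)
    have "caputo a b (\<alpha> k) (X 1) t = f t (\<lambda>j\<in>{1..k}. multiterm_vector a b \<alpha> (X 1) j t)" if t: "t \<in> {a..b}" for t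
    proof -
      have "(\<lambda>j\<in>{1..k}. multiterm_vector a b \<alpha> (X 1) j t) = (\<lambda>j\<in>{1..k}. X j t)"
        using vec t by (intro restrict_ext) auto
      then show ?thesis using x(2)[OF k k t] sol t by (simp add: system_solution_def)
    qed
    then have "multiterm_solution a b k \<alpha> f (X 1)"
      using x(1)[OF k k] by (simp add: multiterm_solution_def)
    moreover have "multiterm_initial a b k \<alpha> xa (X 1)"
      using x(3)[OF k k] by (simp add: multiterm_initial_def)
    moreover have "caputo_exists a b (\<alpha> j) (X 1)" if "j \<in> {1..<k}" for j
      using x(1)[of j] that by (simp add: continuously_caputo_differentiable_def)
    ultimately show ?thesis by blast
  qed
  show ?thesis using part1 part2 by blast
qed

end
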